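(* Let $\Delta\ge 3$ be an integer and let $G$ be a finite simple graph such that either $\Delta=3$ and every node of $G$ has degree at most $3$, or $\Delta\ge 4$ and $G$ is $\Delta$-regular. Then every run of any min-degree greedy algorithm on $G$ (in particular MinGreedy, for every outcome of its random choices, and its deterministic variant with arbitrary tie-breaking) returns a matching $M$ with $|M|\ge \frac{\Delta-1}{2\Delta-3}\,\nu(G)$.
   Context: $\nu(G)$ denotes the size of a maximum matching of $G$. A min-degree greedy algorithm maintains a current graph (initially $G$) and a matching $M$ (initially empty); while the current graph has an edge, it chooses a node $u$ having minimum degree among the non-isolated nodes of the current graph, chooses any neighbor $v$ of $u$ in the current graph, adds $\{u,v\}$ to $M$, and deletes $u$, $v$ and all their incident edges; ties may be broken arbitrarily. MinGreedy is the variant in which $u$ is chosen uniformly at random among the non-isolated minimum-degree nodes and $v$ uniformly at random among the current neighbors of $u$. *)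

theory Defs
  imports "HOL-Library.Disjoint_Sets" "HOL-Probability.Probability_Mass_Function"
begin

definition finite_graph :: "'a set \<Rightarrow> 'a set set \<Rightarrow> bool" where
  "finite_graph V E \<longleftrightarrow> finite V \<and> (\<forall>e\<in>E. e \<subseteq> V \<and> card e = 2)"

definition neighbors :: "'a set set \<Rightarrow> 'a \<Rightarrow> 'a set" where
  "neighbors E u = {v. {u, v} \<in> E}"

definition node_degree :: "'a set set \<Rightarrow> 'a \<Rightarrow> nat" where
  "node_degree E u = card (neighbors E u)"

definition regular :: "nat \<Rightarrow> 'a set \<Rightarrow> 'a set set \<Rightarrow> bool" where
  "regular d V E \<longleftrightarrow> (\<forall>u\<in>V. node_degree E u = d)"

definition is_matching :: "'a set set \<Rightarrow> 'a set set \<Rightarrow> bool" where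
  "is_matching E M \<longleftrightarrow> M \<subseteq> E \<and> disjoint M"

text \<open>The maximum is only meaningful for finite \<open>E\<close>.\<close>
definition matching_number :: "'a set set \<Rightarrow> nat" (\<open>\<nu>\<close>) where
  "\<nu> E = Max {card M | M. is_matching E M}"

definition delete_incident :: "'a set set \<Rightarrow> 'a set \<Rightarrow> 'a set set" where
  "delete_incident E X = {e \<in> E. e \<inter> X = {}}"

definition min_degree_nodes :: "'a set \<Rightarrow> 'a set set \<Rightarrow> 'a set" where
  "min_degree_nodes V E = {u. is_arg_min (node_degree E) (\<lambda>w. w \<in> V \<and> node_degree E w > 0) u}"

text \<open>A state consists of the nodes and edges of the current graph and the matching built so far.
  Nondeterminism of the step relation captures every way of choosing \<open>u\<close> and \<open>v\<close>, be it
  random, deterministic or dependent on the history.\<close>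
inductive greedy_step ::
  "'a set \<times> 'a set set \<times> 'a set set \<Rightarrow> 'a set \<times> 'a set set \<times> 'a set set \<Rightarrow> bool" where
  "\<lbrakk>E \<noteq> {}; u \<in> min_degree_nodes V E; v \<in> neighbors E u\<rbrakk> \<Longrightarrow>
   greedy_step (V, E, M) (V - {u, v}, delete_incident E {u, v}, insert {u, v} M)"

definition greedy_returns :: "'a set \<Rightarrow> 'a set set \<Rightarrow> 'a set set \<Rightarrow> bool" where
  "greedy_returns V E M \<longleftrightarrow> (\<exists>V'. greedy_step\<^sup>*\<^sup>* (V, E, {}) (V', {}, M))"

lemma min_degree_nodesD:
  assumes "u \<in> min_degree_nodes V E"
  shows "u \<in> V" "node_degree E u > 0"
  using assms by (simp_all only: min_degree_nodes_def is_arg_min_def mem_Collect_eq)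

lemma finite_min_degree_nodes: "finite V \<Longrightarrow> finite (min_degree_nodes V E)"
  by (rule finite_subset[OF subsetI]) (rule min_degree_nodesD(1))

lemma finite_neighbors:
  assumes "finite_graph V E"
  shows "finite (neighbors E u)"
proof (rule finite_subset)
  show "neighbors E u \<subseteq> V"
    using assms by (auto simp: finite_graph_def neighbors_def dest: bspec)
  show "finite V"
    using assms by (simp add: finite_graph_def)
qed

lemma min_degree_nodes_nonempty:
  assumes "finite_graph V E" "E \<noteq> {}"
  shows "min_degree_nodes V E \<noteq> {}"
proof -
  obtain e where e: "e \<in> E" using assms(2) by blast
  with assms(1) have eV: "e \<subseteq> V" and "card e = 2"
    unfolding finite_graph_def by blast+
  then obtain x y where exy: "e = {x, y}"
    unfolding card_2_iff by blast
  have "y \<in> neighbors E x"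
    using e exy unfolding neighbors_def by blast
  then have "node_degree E x > 0"
    unfolding node_degree_def using finite_neighbors[OF assms(1)] card_gt_0_iff by blast
  then have ne: "{w \<in> V. node_degree E w > 0} \<noteq> {}" (is "?S \<noteq> {}")
    using eV exy by blast
  have "finite ?S"
    using assms(1) unfolding finite_graph_def by simp
  from ex_is_arg_min_if_finite[OF this ne, of "node_degree E"]
  obtain u where "is_arg_min (node_degree E) (\<lambda>w. w \<in> ?S) u" by blast
  then have "u \<in> min_degree_nodes V E"
    unfolding min_degree_nodes_def by simp
  then show ?thesis by blast
qed

lemma min_degree_nodes_neighbors_nonempty:
  "u \<in> min_degree_nodes V E \<Longrightarrow> neighbors E u \<noteq> {}"
  by (drule min_degree_nodesD(2)) (simp add: node_degree_def card_gt_0_iff)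

text \<open>The distribution of the matching returned by MinGreedy. The test for \<open>finite_graph\<close>
  only makes the function total: it is preserved by deletion of nodes.\<close>
function min_greedy :: "'a set \<Rightarrow> 'a set set \<Rightarrow> 'a set set pmf" where
  "min_greedy V E =
     (if finite_graph V E \<and> E \<noteq> {} then
        do {
          u \<leftarrow> pmf_of_set (min_degree_nodes V E);
          v \<leftarrow> pmf_of_set (neighbors E u);
          map_pmf (insert {u, v}) (min_greedy (V - {u, v}) (delete_incident E {u, v}))
        }
      else return_pmf {})"
  by auto

termination
proof (relation "Wellfounded.measure (\<lambda>(V, E). card V)")
  fix V E and u v :: 'a
  assume G: "finite_graph V E \<and> E \<noteq> {}"
    and u: "u \<in> set_pmf (pmf_of_set (min_degree_nodes V E))"
  have fin: "finite V" using G by (simp add: finite_graph_def)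
  have "u \<in> min_degree_nodes V E"
    using u G fin by (simp add: min_degree_nodes_nonempty finite_min_degree_nodes)
  then have "u \<in> V"
    by (rule min_degree_nodesD(1))
  then have "V - {u, v} \<subset> V" by blast
  then show "((V - {u, v}, delete_incident E {u, v}), (V, E)) \<in> Wellfounded.measure (\<lambda>(V, E). card V)"
    using fin by (simp add: psubset_card_mono)
qed simp

declare min_greedy.simps [simp del]

lemma finite_graph_delete:
  assumes "finite_graph V E"
  shows "finite_graph (V - X) (delete_incident E X)"
  unfolding finite_graph_def
proof (intro conjI ballI)
  show "finite (V - X)"
    using assms by (simp add: finite_graph_def)
  fix e assume "e \<in> delete_incident E X"
  then have e: "e \<in> E" "e \<inter> X = {}"
    by (simp_all add: delete_incident_def)
  then have "e \<subseteq> V" and "card e = 2"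
    using assms by (simp_all add: finite_graph_def)
  with e show "e \<subseteq> V - X" and "card e = 2"
    by blast+
qed

text \<open>On a finite graph every run terminates, and it stops only when no edge is left.\<close>
lemma greedy_progress:
  assumes "finite_graph V E" "E \<noteq> {}"
  shows "\<exists>s. greedy_step (V, E, M) s"
proof -
  obtain u where u: "u \<in> min_degree_nodes V E"
    using min_degree_nodes_nonempty[OF assms] by blast
  obtain v where "v \<in> neighbors E u"
    using min_degree_nodes_neighbors_nonempty[OF u] by blast
  from greedy_step.intros[OF assms(2) u this] show ?thesis by blast
qed

lemma greedy_step_decreases:
  assumes "greedy_step (V, E, M) (V', E', M')" "finite_graph V E"
  shows "finite_graph V' E' \<and> card V' < card V"
  using assms(1)
proof cases
  case (1 u v)
  have "u \<in> V"
    using 1 by (simp only: min_degree_nodesD(1))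
  then have "V' \<subset> V"
    using 1 by blast
  moreover have "finite V"
    using assms(2) unfolding finite_graph_def by blast
  ultimately have "card V' < card V"
    by (simp add: psubset_card_mono)
  moreover have "finite_graph V' E'"
    using finite_graph_delete[OF assms(2)] 1 by simp
  ultimately show ?thesis by blast
qed

end

theory Submission
  imports Defs
begin

text \<open>For a regular graph count edges: a step whose node \<open>u\<close> has full degree \<open>d\<close> removes at most
  \<open>2 * d - 1\<close> edges, every other step at most \<open>2 * d - 2\<close>, and no two full steps are consecutive,
  since the first one leaves a non-isolated node of smaller degree. Hence
  \<open>2 * card E \<le> (4 * d - 3) * card M\<close>, and \<open>2 * d * \<nu> E \<le> d * card V = 2 * card E\<close>.

  For maximum degree three, a step at a leaf lowers \<open>\<nu>\<close> by at most one, so induction reduces to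
  the case that non-isolated nodes have degree at least two. There the sum of \<open>min 2 (deg f)\<close> over the
  nodes \<open>f\<close> left unmatched by the run, which never increases, drops by at most two per step;
  hence at most \<open>card M\<close> non-isolated nodes stay unmatched, and \<open>2 * \<nu> E \<le> 3 * card M\<close>.\<close>

section \<open>Runs of the algorithm\<close>

text \<open>A run without accumulator: the matching is assembled from the last step backwards, so
  rule induction relates each current graph to exactly the edges chosen from it. Both
  \<open>greedy_returns\<close> and \<open>min_greedy\<close> are reduced to this relation.\<close>

inductive greedy_run :: "'a set \<Rightarrow> 'a set set \<Rightarrow> 'a set set \<Rightarrow> bool" where
  stop: "greedy_run V {} {}"
| step: "\<lbrakk>E \<noteq> {}; u \<in> min_degree_nodes V E; v \<in> neighbors E u;
    greedy_run (V - {u, v}) (delete_incident E {u, v}) M\<rbrakk> \<Longrightarrow> greedy_run V E (insert {u, v} M)"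

lemma greedy_returns_imp_greedy_run:
  assumes "greedy_returns V E M"
  shows "greedy_run V E M"
proof -
  \<comment> \<open>The induction goes backwards from the final state, with an arbitrary
    accumulator: the final matching is the one in \<open>s\<close> together with the edges chosen
    after \<open>s\<close>.\<close>
  have "\<exists>M. greedy_run (fst s) (fst (snd s)) M \<and> snd (snd t) = snd (snd s) \<union> M"
    if "greedy_step\<^sup>*\<^sup>* s t" "fst (snd t) = {}" for s t :: "'a set \<times> 'a set set \<times> 'a set set"
    using that
  proof (induction rule: converse_rtranclp_induct)
    case base
    then show ?case by (auto intro: greedy_run.stop)
  next
    case (step s s')
    then obtain M' where M': "greedy_run (fst s') (fst (snd s')) M'" "snd (snd t) = snd (snd s') \<union> M'"
      by blast
    from step.hyps(1) show ?case
    proof cases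
      case (1 E u V v M0)
      have "greedy_run V E (insert {u, v} M')"
        using 1 M'(1) by (intro greedy_run.step) simp_all
      moreover have "snd (snd t) = M0 \<union> insert {u, v} M'"
        using 1 M'(2) by auto
      ultimately show ?thesis
        using 1 by auto
    qed
  qed
  then show ?thesis
    using assms by (fastforce simp: greedy_returns_def)
qed

text \<open>Each outcome in the support comes from concrete choices of \<open>u\<close> and
  \<open>v\<close>; the candidate sets are finite and nonempty, so \<open>pmf_of_set\<close> has
  exactly them as supports.\<close>

lemma min_greedy_imp_greedy_run:
  assumes "finite_graph V E" "M \<in> set_pmf (min_greedy V E)"
  shows "greedy_run V E M"
  using assms
proof (induction V E arbitrary: M rule: min_greedy.induct)
  case (1 V E)
  show ?case
  proof (cases "E = {}")
    case True
    then show ?thesis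
      using 1(3) by (subst (asm) min_greedy.simps) (simp add: greedy_run.stop)
  next
    case False
    let ?P = "pmf_of_set (min_degree_nodes V E)"
    have G: "finite_graph V E \<and> E \<noteq> {}" using False 1(2) by simp
    have setP: "set_pmf ?P = min_degree_nodes V E"
      using 1(2) False
      by (intro set_pmf_of_set min_degree_nodes_nonempty finite_min_degree_nodes)
        (auto simp: finite_graph_def)
    from 1(3) obtain u v M' where u: "u \<in> set_pmf ?P"
      and v: "v \<in> set_pmf (pmf_of_set (neighbors E u))"
      and M': "M' \<in> set_pmf (min_greedy (V - {u, v}) (delete_incident E {u, v}))"
      and M: "M = insert {u, v} M'"
      using False 1(2) by (subst (asm) min_greedy.simps) auto
    have u': "u \<in> min_degree_nodes V E" using u setP by simp
    have v': "v \<in> neighbors E u"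
      using v set_pmf_of_set[OF min_degree_nodes_neighbors_nonempty[OF u'] finite_neighbors[OF 1(2)]]
      by simp
    show ?thesis
      unfolding M using False u' v'
        1(1)[OF G u v finite_graph_delete[OF 1(2)] M']
      by (intro greedy_run.step)
  qed
qed

section \<open>Degrees and deletion of nodes\<close>

lemma neighborsD:
  assumes "finite_graph V E" "v \<in> neighbors E u"
  shows "u \<in> V" "v \<in> V" "u \<noteq> v" "u \<in> neighbors E v"
  using assms unfolding finite_graph_def neighbors_def
  by (auto simp: insert_commute dest!: bspec[of _ _ "{u, v}"] split: if_splits)

lemma neighbors_delete_incident:
  "w \<notin> X \<Longrightarrow> neighbors (delete_incident E X) w = neighbors E w - X"
  by (auto simp: neighbors_def delete_incident_def)

lemma node_degree_delete_incident_le: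
  assumes "finite_graph V E"
  shows "node_degree (delete_incident E X) w \<le> node_degree E w"
  unfolding node_degree_def
  by (rule card_mono[OF finite_neighbors[OF assms]]) (auto simp: neighbors_def delete_incident_def)

text \<open>The additive form avoids truncated subtraction, and over a set of surviving nodes the
  indicators add up to the number of deleted edges that reach it.\<close>

lemma node_degree_delete_pair:
  assumes "finite_graph V E" "w \<notin> {u, v}" "u \<noteq> v"
  shows "node_degree E w = node_degree (delete_incident E {u, v}) w
    + (of_bool (w \<in> neighbors E u) + of_bool (w \<in> neighbors E v))"
proof -
  have sym: "x \<in> neighbors E w \<longleftrightarrow> w \<in> neighbors E x" for x
    by (simp add: neighbors_def insert_commute)
  have "card (neighbors E w) = card (neighbors E w - {u, v}) + card (neighbors E w \<inter> {u, v})"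
    using card_Int_Diff[OF finite_neighbors[OF assms(1)], of w "{u, v}"] by simp
  moreover have "card (neighbors E w \<inter> {u, v})
      = of_bool (w \<in> neighbors E u) + of_bool (w \<in> neighbors E v)"
    using assms(3) by (auto simp: sym Int_insert_right)
  ultimately show ?thesis
    by (simp add: node_degree_def neighbors_delete_incident[OF assms(2)])
qed

lemma min_degree_nodes_le:
  assumes "u \<in> min_degree_nodes V E" "w \<in> V" "node_degree E w > 0"
  shows "node_degree E u \<le> node_degree E w"
  using assms by (auto simp: min_degree_nodes_def is_arg_min_linorder)

lemma node_degree_pos:
  assumes "finite_graph V E"
  shows "node_degree E w > 0 \<longleftrightarrow> neighbors E w \<noteq> {}"
  by (simp add: node_degree_def card_gt_0_iff finite_neighbors[OF assms])

lemma finite_graph_finite_edges: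
  assumes "finite_graph V E"
  shows "finite E"
  using assms finite_subset[of E "Pow V"] by (auto simp: finite_graph_def)

lemma finite_graph_edgeE:
  assumes "finite_graph V E" "e \<in> E"
  obtains x y where "e = {x, y}" "x \<noteq> y" "y \<in> neighbors E x" "x \<in> neighbors E y"
proof -
  have "card e = 2" using assms by (simp add: finite_graph_def)
  then obtain x y where "e = {x, y}" "x \<noteq> y" by (auto simp: card_2_iff)
  then show ?thesis
    using assms(2) that by (auto simp: neighbors_def insert_commute)
qed

section \<open>Matchings\<close>

lemma greedy_run_subset_disjoint:
  assumes "greedy_run V E M" "finite_graph V E"
  shows "M \<subseteq> E \<and> disjoint M"
  using assms
proof induction
  case (step E u V v M)
  then have "M \<subseteq> delete_incident E {u, v}" "disjoint M"
    using finite_graph_delete by blast+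
  moreover have "{u, v} \<in> E" using step.hyps by (simp add: neighbors_def)
  ultimately show ?case
    by (auto simp: disjoint_def delete_incident_def)
qed (simp add: disjoint_def)

lemma greedy_run_matching:
  "greedy_run V E M \<Longrightarrow> finite_graph V E \<Longrightarrow> is_matching E M"
  by (simp add: is_matching_def greedy_run_subset_disjoint)

text \<open>Later edges avoid \<open>u\<close> and \<open>v\<close>, so \<open>{u, v}\<close> is
  new; hence \<open>card M\<close> counts the steps of the run.\<close>

lemma card_insert_greedy_run:
  assumes "greedy_run (V - {u, v}) (delete_incident E {u, v}) M" "finite_graph V E"
  shows "card (insert {u, v} M) = Suc (card M)"
proof -
  have M: "M \<subseteq> delete_incident E {u, v}"
    using assms greedy_run_subset_disjoint finite_graph_delete by blast
  then have "finite M"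
    using finite_graph_finite_edges[OF finite_graph_delete[OF assms(2)]] by (rule finite_subset)
  moreover have "{u, v} \<notin> M" using M by (auto simp: delete_incident_def)
  ultimately show ?thesis by simp
qed

lemma card_Union_matching:
  assumes "finite_graph V E" "is_matching E N"
  shows "card (\<Union>N) = 2 * card N"
proof -
  have N: "e \<subseteq> V \<and> card e = 2" if "e \<in> N" for e
    using that assms by (auto simp: finite_graph_def is_matching_def)
  then have "card (\<Union>N) = (\<Sum>e\<in>N. card e)"
    using assms by (intro card_Union_disjoint) (auto simp: is_matching_def card_eq_0_iff intro: card_ge_0_finite)
  also have "\<dots> = 2 * card N" using N by simp
  finally show ?thesis .
qed

lemma matching_nonisolated:
  assumes "finite_graph V E" "is_matching E N"
  shows "\<Union>N \<subseteq> {w \<in> V. node_degree E w > 0}"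
proof
  fix x assume "x \<in> \<Union>N"
  then obtain e where e: "e \<in> E" "x \<in> e" using assms(2) by (auto simp: is_matching_def)
  obtain a b where "e = {a, b}" "b \<in> neighbors E a" "a \<in> neighbors E b"
    using finite_graph_edgeE[OF assms(1) e(1)] by metis
  with e(2) obtain y where "y \<in> neighbors E x" by blast
  then show "x \<in> {w \<in> V. node_degree E w > 0}"
    using neighborsD(1)[OF assms(1)] node_degree_pos[OF assms(1)] by blast
qed

lemma matching_number_attained:
  assumes "finite_graph V E"
  obtains N where "is_matching E N" "\<nu> E = card N"
proof -
  let ?C = "{card M | M. is_matching E M}"
  have "?C \<subseteq> card ` Pow E" by (auto simp: is_matching_def)
  then have "finite ?C"
    by (rule finite_subset) (simp add: finite_graph_finite_edges[OF assms])
  moreover have "is_matching E {}" by (simp add: is_matching_def disjoint_def)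
  then have "?C \<noteq> {}" by blast
  ultimately have "\<nu> E \<in> ?C" unfolding matching_number_def by (rule Max_in)
  then show ?thesis using that by blast
qed

lemma two_card_matching_le:
  assumes "finite_graph V E" "is_matching E N"
  shows "2 * card N \<le> card V"
proof -
  have "card (\<Union>N) \<le> card V"
    using assms(1) matching_nonisolated[OF assms] by (intro card_mono) (auto simp: finite_graph_def)
  then show ?thesis using card_Union_matching[OF assms] by simp
qed

section \<open>Regular graphs\<close>

text \<open>The handshake lemma, by double counting incidences between nodes and edges.\<close>

lemma sum_node_degree:
  assumes "finite_graph V E"
  shows "(\<Sum>w\<in>V. node_degree E w) = 2 * card E"
proof -
  have fin: "finite V" "finite E"
    using assms finite_graph_finite_edges by (auto simp: finite_graph_def)
  have "node_degree E w = card {e \<in> E. w \<in> e}" for w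
  proof -
    have "bij_betw (\<lambda>x. {w, x}) (neighbors E w) {e \<in> E. w \<in> e}"
      unfolding bij_betw_def
    proof
      show "inj_on (\<lambda>x. {w, x}) (neighbors E w)"
        by (auto simp: inj_on_def doubleton_eq_iff)
      show "(\<lambda>x. {w, x}) ` neighbors E w = {e \<in> E. w \<in> e}"
      proof (intro equalityI subsetI)
        fix e assume e: "e \<in> {e \<in> E. w \<in> e}"
        then obtain x y where "e = {x, y}" "y \<in> neighbors E x" "x \<in> neighbors E y"
          using finite_graph_edgeE[OF assms, of e] by blast
        then show "e \<in> (\<lambda>x. {w, x}) ` neighbors E w" using e by auto
      qed (auto simp: neighbors_def)
    qed
    then show ?thesis by (simp add: node_degree_def bij_betw_same_card)
  qed
  then have "(\<Sum>w\<in>V. node_degree E w) = (\<Sum>w\<in>V. card {e \<in> E. w \<in> e})" by simp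
  also have "\<dots> = (\<Sum>e\<in>E. card {w \<in> V. w \<in> e})"
    using sum.swap_restrict[OF fin, of "\<lambda>_ _. 1::nat" "\<lambda>w e. w \<in> e"] by simp
  also have "\<dots> = (\<Sum>e\<in>E. 2)"
  proof (rule sum.cong)
    fix e assume "e \<in> E"
    then have "{w \<in> V. w \<in> e} = e" "card e = 2" using assms by (auto simp: finite_graph_def)
    then show "card {w \<in> V. w \<in> e} = 2" by simp
  qed simp
  finally show ?thesis by simp
qed

lemma card_edges_delete_pair:
  assumes "finite_graph V E" "v \<in> neighbors E u"
  shows "card E + 1 \<le> card (delete_incident E {u, v}) + node_degree E u + node_degree E v"
proof -
  \<comment> \<open>Removing \<open>u\<close> in \<open>?B\<close> makes the edge
    \<open>{u, v}\<close> count only once; this is the \<open>+ 1\<close> of the statement.\<close>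
  let ?A = "(\<lambda>x. {u, x}) ` neighbors E u" and ?B = "(\<lambda>x. {v, x}) ` (neighbors E v - {u})"
  have "E \<subseteq> delete_incident E {u, v} \<union> (?A \<union> ?B)"
  proof
    fix e assume e: "e \<in> E"
    obtain x y where xy: "e = {x, y}" "y \<in> neighbors E x" "x \<in> neighbors E y"
      using finite_graph_edgeE[OF assms(1) e] by metis
    show "e \<in> delete_incident E {u, v} \<union> (?A \<union> ?B)"
      using e xy by (auto simp: delete_incident_def)
  qed
  moreover have fin: "finite (delete_incident E {u, v} \<union> (?A \<union> ?B))"
    using finite_graph_finite_edges[OF assms(1)] finite_neighbors[OF assms(1)]
    by (auto simp: delete_incident_def)
  ultimately have "card E \<le> card (delete_incident E {u, v} \<union> (?A \<union> ?B))"
    by (rule card_mono[rotated])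
  also have "\<dots> \<le> card (delete_incident E {u, v}) + (card ?A + card ?B)"
    by (meson add_left_mono card_Un_le le_trans)
  also have "card ?A \<le> node_degree E u"
    unfolding node_degree_def by (rule card_image_le[OF finite_neighbors[OF assms(1)]])
  also have "card ?B \<le> card (neighbors E v - {u})"
    by (rule card_image_le) (simp add: finite_neighbors[OF assms(1)])
  also have "\<dots> = node_degree E v - 1"
    using neighborsD(4)[OF assms] by (simp add: node_degree_def)
  finally have "card E \<le> card (delete_incident E {u, v}) + (node_degree E u + (node_degree E v - 1))"
    by simp
  moreover have "node_degree E v > 0"
    using neighborsD(4)[OF assms] node_degree_pos[OF assms(1)] by blast
  ultimately show ?thesis by linarith
qed

text \<open>The indicator amortizes the cost of full steps. In doubled edge counts a full step costs
  at most \<open>4 * d - 2\<close>, one over budget, but raises the indicator from 0 to 1; any other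
  step costs at most \<open>4 * d - 4\<close>, which leaves one unit to pay for the indicator. A
  degree bound replaces regularity because deletion preserves it.\<close>

lemma greedy_run_card_edges:
  assumes "greedy_run V E M" "finite_graph V E" "\<forall>w\<in>V. node_degree E w \<le> d" "d \<ge> 3"
  shows "2 * card E + of_bool (\<exists>w\<in>V. 0 < node_degree E w \<and> node_degree E w < d)
    \<le> (4 * d - 3) * card M"
  using assms
proof induction
  case (stop V)
  then show ?case by (auto simp: node_degree_def neighbors_def)
next
  case (step E u V v M)
  let ?E = "delete_incident E {u, v}" and ?V = "V - {u, v}"
  note fg = step.prems(1)
  have fg': "finite_graph ?V ?E" by (rule finite_graph_delete[OF fg])
  have uv: "u \<in> V" "v \<in> V" "u \<noteq> v" "u \<in> neighbors E v"
    using neighborsD[OF fg step.hyps(3)] by auto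
  have IH: "2 * card ?E + of_bool (\<exists>w\<in>?V. 0 < node_degree ?E w \<and> node_degree ?E w < d)
      \<le> (4 * d - 3) * card M"
    using step.prems node_degree_delete_incident_le[OF fg] fg'
    by (intro step.IH) (auto intro: le_trans)
  have card_M: "card (insert {u, v} M) = Suc (card M)"
    by (rule card_insert_greedy_run[OF step.hyps(4) fg])
  have card_E: "card E + 1 \<le> card ?E + node_degree E u + node_degree E v"
    by (rule card_edges_delete_pair[OF fg step.hyps(3)])
  have deg: "node_degree E u \<le> d" "node_degree E v \<le> d" using step.prems(2) uv by auto
  show ?case
  proof (cases "node_degree E u = d")
    case True
    \<comment> \<open>A second neighbor \<open>w\<close> of \<open>u\<close> has degree
      \<open>d\<close>, by minimality of \<open>u\<close> and the degree bound. It loses one or two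
      edges, so with \<open>d \<ge> 3\<close> it stays non-isolated and becomes deficient.\<close>
    have "card (neighbors E u - {v}) > 0"
      using True \<open>d \<ge> 3\<close> step.hyps(3) by (simp add: node_degree_def)
    then obtain w where w: "w \<in> neighbors E u" "w \<noteq> v" by (auto simp: card_gt_0_iff)
    have w': "w \<in> V" "w \<noteq> u" "u \<in> neighbors E w" using neighborsD[OF fg w(1)] by auto
    have "node_degree E w > 0" using w' node_degree_pos[OF fg] by blast
    then have "node_degree E w = d"
      using min_degree_nodes_le[OF step.hyps(2) w'(1)] True step.prems(2) w'(1)
      by (simp add: order_antisym)
    then have "0 < node_degree ?E w \<and> node_degree ?E w < d"
      using node_degree_delete_pair[OF fg, of w u v] w w' uv \<open>d \<ge> 3\<close> by (auto simp: of_bool_def split: if_splits)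
    then have "\<exists>w\<in>?V. 0 < node_degree ?E w \<and> node_degree ?E w < d"
      using w w' by blast
    then have "2 * card ?E + 1 \<le> (4 * d - 3) * card M"
      using IH by (simp only: of_bool_eq)
    moreover have "2 * card E \<le> 2 * card ?E + 1 + (4 * d - 3)"
      using card_E deg \<open>d \<ge> 3\<close> by linarith
    moreover have "\<not> (\<exists>w\<in>V. 0 < node_degree E w \<and> node_degree E w < d)"
      using min_degree_nodes_le[OF step.hyps(2)] True by (auto simp: not_less)
    ultimately show ?thesis
      using card_M by (simp only: of_bool_eq) simp
  next
    case False
    have "2 * card ?E \<le> (4 * d - 3) * card M" using IH by linarith
    \<comment> \<open>The degrees of \<open>u\<close> and \<open>v\<close> now sum to at most
      \<open>2 * d - 1\<close>, so at most \<open>2 * d - 2\<close> edges disappear and an indicator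
      of 1 still fits.\<close>
    moreover have "2 * card E + 1 \<le> 2 * card ?E + (4 * d - 3)"
      using card_E deg False \<open>d \<ge> 3\<close> by linarith
    ultimately show ?thesis
      using card_M by (auto simp: of_bool_def)
  qed
qed

section \<open>Graphs of maximum degree three\<close>

lemma greedy_run_Union_subset:
  assumes "greedy_run V E M" "finite_graph V E"
  shows "\<Union>M \<subseteq> V"
  using matching_nonisolated[OF assms(2) greedy_run_matching[OF assms]] by blast

text \<open>The cap at two lets a node of degree three lose its first edge for free. The potential
  is zero once no edge is left, so it suffices to bound its drop in each step, according to the
  degree of \<open>u\<close>.\<close>

lemma greedy_run_unmatched_potential:
  assumes "greedy_run V E M" "finite_graph V E" "\<forall>w\<in>V. node_degree E w \<le> 3"
  shows "(\<Sum>f\<in>V - \<Union>M. min 2 (node_degree E f)) \<le> 2 * card M"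
  using assms
proof induction
  case (stop V)
  then show ?case by (simp add: node_degree_def neighbors_def)
next
  case (step E u V v M)
  let ?E = "delete_incident E {u, v}" and ?V = "V - {u, v}"
  define F where "F = V - \<Union>(insert {u, v} M)"
  define k where "k f = (of_bool (f \<in> neighbors E u) + of_bool (f \<in> neighbors E v) :: nat)" for f
  \<comment> \<open>Truncation in this subtraction is harmless: degrees, and hence the capped
    degrees, do not grow under deletion.\<close>
  define drop where "drop f = min 2 (node_degree E f) - min 2 (node_degree ?E f)" for f
  note fg = step.prems(1)
  have fg': "finite_graph ?V ?E" by (rule finite_graph_delete[OF fg])
  have uv: "u \<in> V" "v \<in> V" "u \<noteq> v" "u \<in> neighbors E v"
    using neighborsD[OF fg step.hyps(3)] by auto
  have deg3: "node_degree E w \<le> 3" if "w \<in> V" for w using step.prems(2) that by blast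
  have degu: "node_degree E u > 0" using min_degree_nodesD[OF step.hyps(2)] by simp
  have FM: "F = ?V - \<Union>M" and F_sub: "F \<subseteq> V - {u, v}" by (auto simp: F_def)
  have finF: "finite F" using fg by (auto simp: F_def finite_graph_def)
  \<comment> \<open>\<open>F\<close> is also the set of nodes left unmatched by the rest of the run,
    so both potentials range over the same nodes.\<close>
  have IH: "(\<Sum>f\<in>F. min 2 (node_degree ?E f)) \<le> 2 * card M"
    unfolding FM using step.prems node_degree_delete_incident_le[OF fg] fg'
    by (intro step.IH) (auto intro: le_trans)
  have deg_k: "node_degree E f = node_degree ?E f + k f" if "f \<in> F" for f
    using node_degree_delete_pair[OF fg _ uv(3)] that F_sub unfolding k_def by blast
  have mindeg: "node_degree E f = 0 \<or> node_degree E u \<le> node_degree E f" if "f \<in> V" for f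
    using min_degree_nodes_le[OF step.hyps(2) that] by auto
  have k2: "k f \<le> 2" for f by (auto simp: k_def)
  have sum_k: "(\<Sum>f\<in>F. k f) = card (F \<inter> neighbors E u) + card (F \<inter> neighbors E v)"
    using finF by (simp add: k_def sum.distrib Int_def)
  have nu: "F \<inter> neighbors E u \<subseteq> neighbors E u - {v}" and nv: "F \<inter> neighbors E v \<subseteq> neighbors E v - {u}"
    using F_sub by auto
  have fin_nb: "finite (neighbors E w)" for w by (rule finite_neighbors[OF fg])
  have card_nu: "card (neighbors E u - {v}) = node_degree E u - 1"
    using step.hyps(3) by (simp add: node_degree_def)
  have card_nv: "card (neighbors E v - {u}) = node_degree E v - 1"
    using uv(4) by (simp add: node_degree_def)
  have le_u: "card (F \<inter> neighbors E u) \<le> node_degree E u - 1"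
    using card_mono[OF _ nu] fin_nb card_nu by simp
  have le_v: "card (F \<inter> neighbors E v) \<le> node_degree E v - 1"
    using card_mono[OF _ nv] fin_nb card_nv by simp
  have le_v2: "card (F \<inter> neighbors E v) \<le> 2" using le_v deg3[OF uv(2)] by linarith
  have drop_k: "drop f \<le> k f" if "f \<in> F" for f
    using deg_k[OF that] by (auto simp: drop_def)
  have sum_drop_k: "sum drop F \<le> sum k F" using drop_k by (rule sum_mono)
  have "sum drop F \<le> 2"
  proof -
    consider "node_degree E u = 1" | "node_degree E u = 2" | "node_degree E u = 3"
      using degu deg3[OF uv(1)] by linarith
    then show ?thesis
    proof cases
      case 1
      \<comment> \<open>The only neighbor of \<open>u\<close> is \<open>v\<close>, so only the at
        most two other edges at \<open>v\<close> can reach \<open>F\<close>.\<close>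
      then show ?thesis using sum_drop_k sum_k le_u le_v2 by linarith
    next
      case 3
      \<comment> \<open>All non-isolated nodes have degree three: losing one edge costs nothing,
        losing two costs one. At most four deleted edges reach \<open>F\<close>.\<close>
      have "2 * drop f \<le> k f" if "f \<in> F" for f
        using deg_k[OF that] k2[of f] mindeg[of f] deg3[of f] that F_sub 3 by (auto simp: drop_def min_def)
      then have "2 * sum drop F \<le> sum k F"
        unfolding sum_distrib_left by (rule sum_mono)
      then show ?thesis using sum_k le_u le_v2 3 by linarith
    next
      case 2
      show ?thesis
      proof (cases "sum k F \<le> 2")
        case False
        \<comment> \<open>At most one edge from \<open>u\<close> and two from \<open>v\<close> reach
          \<open>F\<close>; a total above two forces equality in both bounds.\<close>
        then have "card (F \<inter> neighbors E u) = node_degree E u - 1"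
          "card (F \<inter> neighbors E v) = node_degree E v - 1"
          using sum_k le_u le_v le_v2 deg3[OF uv(2)] 2 by linarith+
        then have eq: "F \<inter> neighbors E u = neighbors E u - {v}" "F \<inter> neighbors E v = neighbors E v - {u}"
          using card_subset_eq[OF _ nu] card_subset_eq[OF _ nv] fin_nb card_nu card_nv by auto
        text \<open>All deleted edges other than \<open>{u, v}\<close> end in \<open>F\<close>, so the nodes still to be matched keep
          their degree of at least two; if \<open>f\<close> became a leaf, the next step would select a node of \<open>F\<close>.\<close>
        have no_leaf: "node_degree ?E f \<noteq> 1" if f: "f \<in> F" for f
        proof
          assume leaf: "node_degree ?E f = 1"
          then have "?E \<noteq> {}" by (auto simp: node_degree_def neighbors_def)
          with step.hyps(4) obtain x where x: "x \<in> min_degree_nodes ?V ?E" and xM: "x \<in> \<Union>M"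
            by cases auto
          have "f \<in> ?V" using f F_sub by blast
          then have "node_degree ?E x = 1"
            using min_degree_nodes_le[OF x] min_degree_nodesD(2)[OF x] leaf by fastforce
          moreover have "x \<in> ?V" by (rule min_degree_nodesD(1)[OF x])
          moreover have "x \<notin> F" using xM by (auto simp: FM)
          then have "x \<notin> neighbors E u" "x \<notin> neighbors E v"
            using eq \<open>x \<in> ?V\<close> by blast+
          ultimately have "node_degree E x = 1"
            using node_degree_delete_pair[OF fg, of x u v] uv(3) by auto
          then show False using mindeg[of x] 2 \<open>x \<in> ?V\<close> by auto
        qed
        \<comment> \<open>Capped degrees are 0 or 2 both before and after the step. The total drop
          is thus even, and being at most three it is at most two.\<close>
        have "2 dvd drop f" if "f \<in> F" for f
        proof -
          have "node_degree E f \<noteq> 1" using mindeg[of f] 2 that F_sub by auto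
          then have "drop f \<in> {0, 2}"
            using no_leaf[OF that] deg_k[OF that] by (auto simp: drop_def min_def)
          then show ?thesis by auto
        qed
        then have "2 dvd sum drop F" by (rule dvd_sum)
        then have "sum drop F \<noteq> 3" by (intro notI) simp
        moreover have "sum drop F \<le> 3" using sum_drop_k sum_k le_u le_v2 2 by linarith
        ultimately show ?thesis by linarith
      qed (use sum_drop_k in linarith)
    qed
  qed
  moreover have "(\<Sum>f\<in>F. min 2 (node_degree E f)) = (\<Sum>f\<in>F. min 2 (node_degree ?E f) + drop f)"
    by (rule sum.cong) (auto simp: drop_def deg_k)
  ultimately have "(\<Sum>f\<in>F. min 2 (node_degree E f)) \<le> 2 * Suc (card M)"
    using IH by (simp add: sum.distrib)
  then show ?case
    unfolding F_def card_insert_greedy_run[OF step.hyps(4) fg] .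
qed

text \<open>An arbitrary \<open>N\<close> in place of a maximum matching lets the leaf case apply
  the induction hypothesis to the part of \<open>N\<close> that survives the step.\<close>

lemma greedy_run_subcubic:
  assumes "greedy_run V E M" "finite_graph V E" "\<forall>w\<in>V. node_degree E w \<le> 3" "is_matching E N"
  shows "2 * card N \<le> 3 * card M"
  using assms
proof (induction arbitrary: N)
  case (stop V)
  then show ?case by (simp add: is_matching_def)
next
  case (step E u V v M)
  let ?E = "delete_incident E {u, v}" and ?V = "V - {u, v}" and ?M = "insert {u, v} M"
  note fg = step.prems(1)
  have finN: "finite N"
    using step.prems(3) finite_graph_finite_edges[OF fg] by (auto simp: is_matching_def intro: finite_subset)
  have card_M: "card ?M = Suc (card M)"
    by (rule card_insert_greedy_run[OF step.hyps(4) fg])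
  have run: "greedy_run V E ?M" using step.hyps by (rule greedy_run.step)
  have degu: "node_degree E u > 0" using min_degree_nodesD[OF step.hyps(2)] by simp
  show ?case
  proof (cases "node_degree E u = 1")
    case True
    then have nb: "neighbors E u = {v}"
      using step.hyps(3) unfolding node_degree_def by (metis card_1_singletonE singletonD)
    \<comment> \<open>As \<open>v\<close> is the only neighbor of the leaf \<open>u\<close>, every
      edge of \<open>N\<close> meeting \<open>{u, v}\<close> contains \<open>v\<close>; by
      disjointness at most one edge is lost.\<close>
    let ?N = "{e \<in> N. e \<inter> {u, v} = {}}"
    have v_in: "v \<in> e" if e: "e \<in> N - ?N" for e
    proof -
      have "e \<in> E" using e step.prems(3) by (auto simp: is_matching_def)
      then obtain x y where "e = {x, y}" "y \<in> neighbors E x" "x \<in> neighbors E y"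
        using finite_graph_edgeE[OF fg, of e] by blast
      then show ?thesis using e nb by auto
    qed
    have "e = e'" if "e \<in> N - ?N" "e' \<in> N - ?N" for e e'
      using that v_in[OF that(1)] v_in[OF that(2)] step.prems(3)
      unfolding is_matching_def disjoint_def by blast
    then have "card (N - ?N) \<le> 1"
      using card_le_Suc0_iff_eq[of "N - ?N"] finN by simp
    moreover have "card N = card ?N + card (N - ?N)"
      using card_Int_Diff[OF finN, of ?N] by (simp only: Int_absorb1[OF Collect_restrict])
    moreover have "is_matching ?E ?N"
      using step.prems(3) by (auto simp: is_matching_def disjoint_def delete_incident_def)
    then have "2 * card ?N \<le> 3 * card M"
      using step.prems node_degree_delete_incident_le[OF fg]
      by (intro step.IH finite_graph_delete) (auto intro: le_trans)
    ultimately show ?thesis using card_M by simp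
  next
    case False
    let ?W = "{w \<in> V. node_degree E w > 0}"
    have finV: "finite V" using fg by (simp add: finite_graph_def)
    have deg2: "node_degree E w \<ge> 2" if "w \<in> ?W" for w
      using min_degree_nodes_le[OF step.hyps(2), of w] degu False that by simp
    \<comment> \<open>With no leaves, every unmatched non-isolated node contributes exactly two to
      the potential of the whole run.\<close>
    have "2 * card (?W - \<Union>?M) = (\<Sum>f\<in>?W - \<Union>?M. min 2 (node_degree E f))"
      using deg2 by (simp add: min_absorb1)
    also have "\<dots> \<le> (\<Sum>f\<in>V - \<Union>?M. min 2 (node_degree E f))"
      using finV by (intro sum_mono2) auto
    also have "\<dots> \<le> 2 * card ?M"
      by (rule greedy_run_unmatched_potential[OF run fg step.prems(2)])
    finally have F: "card (?W - \<Union>?M) \<le> card ?M" by simp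
    \<comment> \<open>\<open>N\<close> covers only non-isolated nodes: those covered by the run
      number \<open>2 * card ?M\<close>, the others at most \<open>card ?M\<close>.\<close>
    have "2 * card N = card (\<Union>N)" using card_Union_matching[OF fg step.prems(3)] by simp
    also have "\<dots> \<le> card (\<Union>?M \<union> (?W - \<Union>?M))"
      using matching_nonisolated[OF fg step.prems(3)] finV greedy_run_Union_subset[OF run fg]
      by (intro card_mono) (auto intro: finite_subset)
    also have "\<dots> \<le> card (\<Union>?M) + card (?W - \<Union>?M)" by (rule card_Un_le)
    also have "card (\<Union>?M) = 2 * card ?M"
      by (rule card_Union_matching[OF fg greedy_run_matching[OF run fg]])
    finally show ?thesis using F by linarith
  qed
qed

section \<open>The approximation ratios\<close>

lemma greedy_run_regular:
  assumes "greedy_run V E M" "finite_graph V E" "regular d V E" "d \<ge> 3" "is_matching E N"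
  shows "2 * d * card N \<le> (4 * d - 3) * card M"
proof -
  have "d * card V = 2 * card E"
    using sum_node_degree[OF assms(2)] assms(3) by (simp add: regular_def mult.commute)
  moreover have "2 * card E \<le> (4 * d - 3) * card M"
    using greedy_run_card_edges[OF assms(1,2) _ assms(4)] assms(3) by (fastforce simp: regular_def)
  moreover have "d * (2 * card N) \<le> d * card V"
    using two_card_matching_le[OF assms(2,5)] by (rule mult_le_mono2)
  ultimately show ?thesis by (simp add: mult.commute mult.left_commute)
qed

theorem theorem3:
  fixes V :: "'a set" and E :: "'a set set" and \<Delta> :: nat
  assumes "finite_graph V E"
    and "\<Delta> \<ge> 3"
    and "\<Delta> = 3 \<and> (\<forall>u\<in>V. node_degree E u \<le> 3) \<or> \<Delta> \<ge> 4 \<and> regular \<Delta> V E"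
  shows "(\<forall>M. greedy_returns V E M \<longrightarrow>
            is_matching E M \<and>
            real (card M) \<ge> (real \<Delta> - 1) / (2 * real \<Delta> - 3) * real (\<nu> E)) \<and>
         (\<forall>M \<in> set_pmf (min_greedy V E).
            is_matching E M \<and>
            real (card M) \<ge> (real \<Delta> - 1) / (2 * real \<Delta> - 3) * real (\<nu> E))"
proof -
  obtain N where N: "is_matching E N" "\<nu> E = card N"
    using matching_number_attained[OF assms(1)] .
  have "real (card M) \<ge> (real \<Delta> - 1) / (2 * real \<Delta> - 3) * real (\<nu> E)" if run: "greedy_run V E M" for M
  proof -
    let ?m = "real (card M)" and ?n = "real (card N)" and ?d = "real \<Delta>"
    have d: "?d \<ge> 3" using assms(2) by simp
    have "(?d - 1) * ?n \<le> (2 * ?d - 3) * ?m"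
      using assms(3)
    proof
      assume "\<Delta> = 3 \<and> (\<forall>u\<in>V. node_degree E u \<le> 3)"
      \<comment> \<open>For \<Delta> = 3 the claimed ratio is 2/3, exactly the subcubic
        bound.\<close>
      then show ?thesis
        using greedy_run_subcubic[OF run assms(1) _ N(1)] by simp
    next
      assume "\<Delta> \<ge> 4 \<and> regular \<Delta> V E"
      then have "2 * \<Delta> * card N \<le> (4 * \<Delta> - 3) * card M"
        using greedy_run_regular[OF run assms(1) _ assms(2) N(1)] by simp
      then have "real (2 * \<Delta> * card N) \<le> real ((4 * \<Delta> - 3) * card M)"
        by (simp only: of_nat_le_iff)
      then have "2 * ?d * ?n \<le> (4 * ?d - 3) * ?m"
        using assms(2) by (simp add: of_nat_diff)
      \<comment> \<open>The ratio obtained from edge counting is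
        \<open>2 * ?d / (4 * ?d - 3)\<close>. It is at least the claimed one, since
        \<open>2 * ?d * (2 * ?d - 3)\<close> exceeds \<open>(?d - 1) * (4 * ?d - 3)\<close> by
        \<open>?d - 3\<close>.\<close>
      then have "(?d - 1) * (2 * ?d * ?n) \<le> (?d - 1) * ((4 * ?d - 3) * ?m)"
        using d by (intro mult_left_mono) simp_all
      also have "\<dots> = 2 * ?d * ((2 * ?d - 3) * ?m) - (?d - 3) * ?m"
        by (simp add: algebra_simps)
      also have "\<dots> \<le> 2 * ?d * ((2 * ?d - 3) * ?m)"
        using d by simp
      finally have "(2 * ?d) * ((?d - 1) * ?n) \<le> (2 * ?d) * ((2 * ?d - 3) * ?m)"
        by (simp only: mult.left_commute mult.assoc)
      then show ?thesis using d by (simp only: mult_le_cancel_left_pos)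
    qed
    then show ?thesis using d N(2) by (simp add: field_simps)
  qed
  then show ?thesis
    using greedy_returns_imp_greedy_run min_greedy_imp_greedy_run[OF assms(1)]
      greedy_run_matching[OF _ assms(1)] by blast
qed

end
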